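(* Let $n\ge 2$, $h:=1/(n-1)$, and let $(\alpha,u)=(\alpha,u_1,\ldots,u_n)\in(\mathbb{R}_{>0})^{n+1}$ satisfy $$\left\{\begin{array}{rcl} 0&=&-(u_2-u_1)+\frac{h^2}{2}g_1(u_1),\\ 0&=&-(u_{k+1}-2u_k+u_{k-1})+h^2g_1(u_k)\quad(2\le k\le n-1),\\ 0&=&-(u_{n-1}-u_n)+\frac{h^2}{2}g_1(u_n)-h\alpha\, g_2(u_n).\end{array}\right.$$ If the function $g:=g_1/g_2:\mathbb{R}_{>0}\to\mathbb{R}_{>0}$ is surjective and strictly decreasing, then $u_n<g^{-1}(\alpha)$.
   Context: $g_1,g_2:\mathbb{R}\to\mathbb{R}$ are functions of class $\mathcal{C}^3(\mathbb{R})$ such that $g_i(0)=0$, $g_i'(x)>0$, $g_i''(x)>0$ and $g_i'''(x)\ge 0$ for all $x>0$ and $i=1,2$. *)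

theory Defs
  imports "HOL-Analysis.Analysis"
begin

definition C_k_real :: "nat \<Rightarrow> (real \<Rightarrow> real) \<Rightarrow> bool" where
  "C_k_real k f \<longleftrightarrow>
     (\<forall>j<k. \<forall>x. (deriv ^^ j) f differentiable (at x)) \<and> continuous_on UNIV ((deriv ^^ k) f)"

definition admissible :: "(real \<Rightarrow> real) \<Rightarrow> bool" where
  "admissible f \<longleftrightarrow> C_k_real 3 f \<and> f 0 = 0 \<and>
     (\<forall>x>0. deriv f x > 0 \<and> (deriv ^^ 2) f x > 0 \<and> (deriv ^^ 3) f x \<ge> 0)"

end

theory Submission
  imports Defs
begin

text \<open>
  Since \<open>g1 / g2\<close> is strictly decreasing on the positive reals, the claim amounts to
  \<open>\<alpha> < g1 (u n) / g2 (u n)\<close>. Adding up all the equations telescopes the second differences and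
  leaves \<open>\<alpha> * g2 (u n) = h * (g1 (u 1) / 2 + g1 (u 2) + \<dots> + g1 (u (n - 1)) + g1 (u n) / 2)\<close>,
  the composite trapezoidal rule on \<open>[0, 1]\<close>. The weights on the right add up to
  \<open>h * (n - 1) = 1\<close>, and \<open>g1\<close> is strictly increasing along the strictly increasing sequence
  \<open>u 1 < \<dots> < u n\<close>, so the right-hand side is less than \<open>g1 (u n)\<close>. The lemma
  \<open>increment_bounds\<close> carries this out without the sum, by an induction that bounds each increment
  \<open>u (k + 1) - u k\<close> by its partial weight times the current value of \<open>g1\<close>.
\<close>

lemma admissible_strict_mono_on:
  assumes "admissible f"
  shows "strict_mono_on {0..} f"
proof (rule strict_mono_onI)
  fix x y :: real
  assume "x \<in> {0..}" "y \<in> {0..}" "x < y"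
  have diff: "f differentiable (at z)" for z
    using assms unfolding admissible_def C_k_real_def by (auto dest: spec[of _ 0])
  show "f x < f y"
  proof (rule DERIV_pos_imp_increasing_open[OF \<open>x < y\<close>])
    fix z assume "x < z" "z < y"
    with \<open>x \<in> {0..}\<close> have "deriv f z > 0"
      using assms unfolding admissible_def by auto
    moreover have "DERIV f z :> deriv f z"
      using diff by (simp add: DERIV_deriv_iff_real_differentiable)
    ultimately show "\<exists>d. DERIV f z :> d \<and> d > 0"
      by blast
  next
    show "continuous_on {x..y} f"
      using diff by (intro continuous_at_imp_continuous_on ballI differentiable_imp_continuous_within)
  qed
qed

lemma admissible_pos:
  assumes "admissible f" and "x > 0"
  shows "f x > 0"
  using strict_mono_onD[OF admissible_strict_mono_on[OF assms(1)], of 0 x] assms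
  by (simp add: admissible_def)

text \<open>
  The number \<open>real k - 1 / 2\<close> is the total weight of the nodes \<open>1, \<dots>, k\<close> in the trapezoidal
  sum, in which the first node counts one half.
\<close>

lemma increment_bounds:
  fixes f :: "real \<Rightarrow> real" and u :: "nat \<Rightarrow> real"
  assumes mono: "mono_on {0<..} f" and pos: "\<And>x. x > 0 \<Longrightarrow> f x > 0"
    and "c > 0" and u_pos: "\<And>k. k \<in> {1..n} \<Longrightarrow> u k > 0"
    and first: "u 2 - u 1 = c / 2 * f (u 1)"
    and inner: "\<And>k. k \<in> {2..n - 1} \<Longrightarrow> u (k + 1) - 2 * u k + u (k - 1) = c * f (u k)"
    and "1 \<le> k" "k < n"
  shows "0 < u (k + 1) - u k \<and> u (k + 1) - u k \<le> c * (real k - 1 / 2) * f (u k)"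
  using \<open>1 \<le> k\<close> \<open>k < n\<close>
proof (induction k rule: dec_induct)
  case base
  then have "c / 2 * f (u 1) > 0"
    using pos u_pos \<open>c > 0\<close> by simp
  moreover have "u (1 + 1) - u 1 = c / 2 * f (u 1)"
    using first by (simp only: one_add_one)
  ultimately show ?case
    by simp
next
  case (step k)
  then have IH: "0 < u (k + 1) - u k" "u (k + 1) - u k \<le> c * (real k - 1 / 2) * f (u k)"
    by simp_all
  have u: "u k > 0" "u (k + 1) > 0"
    using step u_pos by simp_all
  have "k + 1 \<in> {2..n - 1}"
    using \<open>1 \<le> k\<close> \<open>Suc k < n\<close> by auto
  then have eq: "u (k + 2) - u (k + 1) = (u (k + 1) - u k) + c * f (u (k + 1))"
    using inner[OF \<open>k + 1 \<in> {2..n - 1}\<close>] by (simp add: algebra_simps)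
  have "f (u k) \<le> f (u (k + 1))"
    using mono_onD[OF mono, of "u k" "u (k + 1)"] u IH(1) by simp
  then have "c * (real k - 1 / 2) * f (u k) \<le> c * (real k - 1 / 2) * f (u (k + 1))"
    using \<open>c > 0\<close> step by (intro mult_left_mono) auto
  with IH(2) eq have "u (k + 2) - u (k + 1) \<le> c * (real (k + 1) - 1 / 2) * f (u (k + 1))"
    by (simp add: algebra_simps)
  moreover have "c * f (u (k + 1)) > 0"
    using \<open>c > 0\<close> pos u by simp
  then have "0 < u (k + 2) - u (k + 1)"
    using eq IH(1) by linarith
  ultimately show ?case
    by simp
qed

theorem corollary8:
  fixes g1 g2 :: "real \<Rightarrow> real" and n :: nat and h \<alpha> :: real and u :: "nat \<Rightarrow> real"
  assumes "admissible g1" and "admissible g2"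
    and "n \<ge> 2" and "h = 1 / (real n - 1)"
    and "\<alpha> > 0" and "\<forall>k\<in>{1..n}. u k > 0"
    and "0 = - (u 2 - u 1) + h\<^sup>2 / 2 * g1 (u 1)"
    and "\<forall>k\<in>{2..n - 1}. 0 = - (u (k + 1) - 2 * u k + u (k - 1)) + h\<^sup>2 * g1 (u k)"
    and "0 = - (u (n - 1) - u n) + h\<^sup>2 / 2 * g1 (u n) - h * \<alpha> * g2 (u n)"
    and "(\<lambda>x. g1 x / g2 x) ` {0<..} = {0<..}"
    and "strict_antimono_on {0<..} (\<lambda>x. g1 x / g2 x)"
  shows "u n < inv_into {0<..} (\<lambda>x. g1 x / g2 x) \<alpha>"
proof -
  let ?g = "\<lambda>x. g1 x / g2 x"
  have "h > 0" and h: "h * (real n - 1) = 1"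
    using assms(3,4) by auto
  have mono1: "strict_mono_on {0..} g1"
    using admissible_strict_mono_on assms(1) .
  have un: "u n > 0" "u (n - 1) > 0"
    using assms(3,6) by auto
  have "0 < u (n - 1 + 1) - u (n - 1) \<and>
    u (n - 1 + 1) - u (n - 1) \<le> h\<^sup>2 * (real (n - 1) - 1 / 2) * g1 (u (n - 1))"
  proof (rule increment_bounds[where n = n])
    show "mono_on {0<..} g1"
      using strict_mono_on_imp_mono_on[OF mono1] by (rule mono_on_subset) auto
    show "u (k + 1) - 2 * u k + u (k - 1) = h\<^sup>2 * g1 (u k)" if "k \<in> {2..n - 1}" for k
      using bspec[OF assms(8) that] by linarith
    show "u 2 - u 1 = h\<^sup>2 / 2 * g1 (u 1)"
      using assms(7) by linarith
  qed (use assms(3,6) admissible_pos[OF assms(1)] \<open>h > 0\<close> in auto)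
  then have less: "u (n - 1) < u n"
    and le: "u n - u (n - 1) \<le> h\<^sup>2 * (real n - 3 / 2) * g1 (u (n - 1))"
    using assms(3) by (simp_all add: of_nat_diff)
  have "g1 (u (n - 1)) < g1 (u n)"
    using strict_mono_onD[OF mono1 _ _ less] un by simp
  then have "h\<^sup>2 * (real n - 3 / 2) * g1 (u (n - 1)) < h\<^sup>2 * (real n - 3 / 2) * g1 (u n)"
    using assms(3) \<open>h > 0\<close> by (intro mult_strict_left_mono) auto
  with le assms(9) have "h * \<alpha> * g2 (u n) < h\<^sup>2 * (real n - 3 / 2) * g1 (u n) + h\<^sup>2 / 2 * g1 (u n)"
    by linarith
  also have "\<dots> = h * (h * (real n - 1)) * g1 (u n)"
    by (simp add: field_simps power2_eq_square)
  finally have "\<alpha> * g2 (u n) < g1 (u n)"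
    using \<open>h > 0\<close> by (simp add: h mult.assoc)
  then have \<alpha>_less: "\<alpha> < ?g (u n)"
    using admissible_pos[OF assms(2) un(1)] by (simp add: pos_less_divide_eq)
  define x where "x = inv_into {0<..} ?g \<alpha>"
  have "\<alpha> \<in> ?g ` {0<..}"
    using assms(5,10) by simp
  then have x: "x \<in> {0<..}" "?g x = \<alpha>"
    unfolding x_def by (rule inv_into_into, rule f_inv_into_f[where f = ?g])
  show ?thesis
    unfolding x_def[symmetric]
  proof (rule ccontr)
    assume "\<not> u n < x"
    then consider "x < u n" | "x = u n"
      by linarith
    then show False
    proof cases
      case 1
      then have "?g (u n) < ?g x"
        using monotone_onD[OF assms(11), of x "u n"] x un by simp
      with \<alpha>_less x show False
        by simp
    next
      case 2
      with \<alpha>_less x show False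
        by simp
    qed
  qed
qed

end
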